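(* Let $q$ be a prime power, let $r,l,k$ be positive integers with $r\mid k$ and $k/r\le l$, and let $h(x)=\frac{f(x)}{g(x)}\in\mathbb{F}_q(x)$, with $f,g\in\mathbb{F}_q[x]$ coprime, be an $(r,l)$-good rational function. Let $A_1,\dots,A_l\subseteq\mathbb{P}^1(\mathbb{F}_q)$ be pairwise disjoint subsets with $|A_i|=r+1$ and $h(A_i)=\{t_i\}$, $t_i\in\mathbb{P}^1(\mathbb{F}_q)$, for $1\le i\le l$, and let $A=\bigcup_{i=1}^{l}A_i$. Suppose $b\in\mathbb{F}_q$ satisfies $b\notin h(\mathbb{P}^1(\mathbb{F}_q))$. For $a\in\mathbb{F}_q^k$, written as $a=(a_{ij})$ with $0\le i\le r-1$, $0\le j\le \frac{k}{r}-1$, put $$h_a(x)=\sum_{i=0}^{r-1}\sum_{j=0}^{\frac{k}{r}-1}a_{ij}\left(\frac{g(x)}{f(x)-b\,g(x)}\right)^{j}x^{i}.$$ Define the code $\mathcal{C}$ as follows. (i) If $\infty\notin A$, let $\mathcal{C}=\{(h_a(x))_{x\in A} : a\in\mathbb{F}_q^k\}$. (ii) If $\infty\in A_e$ for some $1\le e\le l$, let $\mathcal{C}=\{((h_a(x))_{x\in A\setminus\{\infty\}},\,c_\infty) : a\in\mathbb{F}_q^k\}$, where $c_\infty=c_\infty(a)=\sum_{j=0}^{\frac{k}{r}-1}a_{(r-1)j}\left(\frac{1}{t_e-b}\right)^{j}$. Let $n=(r+1)l$. Then $\mathcal{C}$ is an optimal $(n,k,r)$-LRC over $\mathbb{F}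_q$.
   Context: $\mathbb{P}^1(\mathbb{F}_q)=\mathbb{F}_q\cup\{\infty\}$. For coprime $f,g$, the degree of $h=f/g$ is $\deg(h)=\max\{\deg f,\deg g\}$, and $h$ induces by evaluation a map $h:\mathbb{P}^1(\mathbb{F}_q)\to\mathbb{P}^1(\mathbb{F}_q)$. A rational function $h\in\mathbb{F}_q(x)$ is $(r,l)$-good ($l\geq 1$) if $\deg(h)=r+1$ and there exist $l$ pairwise disjoint subsets $A_1,\dots,A_l$ of $\mathbb{P}^1(\mathbb{F}_q)$ with $|A_i|=r+1$ and $h(A_i)=\{t_i\}$ for some $t_i\in\mathbb{P}^1(\mathbb{F}_q)$. An $(n,k,r)$-locally recoverable code (LRC) over $\mathbb{F}_q$ is a $k$-dimensional linear subspace $\mathcal{C}\subseteq\mathbb{F}_q^n$ such that any single erased coordinate of a codeword can be recovered from at most $r$ other coordinates; i.e. for every coordinate position $s$ there is a set $I_s$ of at most $r$ other positions such that for every $c\in\mathcal{C}$ the value $c_s$ is determined by $(c_u)_{u\in I_s}$. Every $(n,k,r)$-LRC has minimum distance $d(\mathcal{C})\le n-k-\lceil k/r\rceil+2$; it is called optimal if equality holds. Conventions: a $0$-th power equals $1$ (also for base $0$), and $\frac{1}{t_e-b}=0$ if $t_e=\infty$. *)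

theory Defs
  imports
    "HOL-Analysis.Cartesian_Space"
    "HOL-Computational_Algebra.Polynomial"
    "HOL-Computational_Algebra.Fraction_Field"
    "HOL-Library.Disjoint_Sets"
begin

section \<open>Rational functions and the projective line\<close>

text \<open>The field of rational functions over \<open>'a\<close> is \<open>'a poly fract\<close>.\<close>

datatype 'a proj_line = Fin 'a | Infty

definition lowest_terms :: "'a::field poly fract \<Rightarrow> 'a poly \<Rightarrow> 'a poly \<Rightarrow> bool" where
  "lowest_terms h f g \<longleftrightarrow> g \<noteq> 0 \<and> coprime f g \<and> h = Fract f g"

definition ratfun_degree :: "'a::field poly fract \<Rightarrow> nat" where
  "ratfun_degree h = (THE d. \<exists>f g. lowest_terms h f g \<and> d = max (degree f) (degree g))"

text \<open>
  Evaluation on the projective line of the fraction \<open>f / g\<close> for coprime \<open>f\<close> and \<open>g\<close>. At infinity,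
  homogenizing \<open>f\<close> and \<open>g\<close> to the common degree \<open>d = max (degree f) (degree g)\<close> leaves the
  quotient of their coefficients at \<open>d\<close>.
\<close>

definition frac_eval :: "'a::field poly \<Rightarrow> 'a poly \<Rightarrow> 'a proj_line \<Rightarrow> 'a proj_line" where
  "frac_eval f g P =
     (case P of
        Fin x \<Rightarrow> if poly g x = 0 then Infty else Fin (poly f x / poly g x)
      | Infty \<Rightarrow>
          (let d = max (degree f) (degree g)
           in if coeff g d = 0 then Infty else Fin (coeff f d / coeff g d)))"

definition ratfun_eval :: "'a::field poly fract \<Rightarrow> 'a proj_line \<Rightarrow> 'a proj_line" where
  "ratfun_eval h P = (THE Q. \<exists>f g. lowest_terms h f g \<and> Q = frac_eval f g P)"

text \<open>Both descriptions are independent of the chosen representation in lowest terms.\<close>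

lemma coprime_poly_dvd_mult:
  fixes f g u :: "'a::field poly"
  assumes cop: "coprime f g" and "g \<noteq> 0" and "g dvd f * u"
  shows "g dvd u"
proof -
  define S where "S = {d. d \<noteq> 0 \<and> (\<exists>v w. d = v * f + w * g)}"
  have "g = 0 * f + 1 * g"
    by simp
  then have "g \<in> S"
    unfolding S_def using \<open>g \<noteq> 0\<close> by blast
  then obtain d where d: "d \<in> S" and least: "\<And>e. e \<in> S \<Longrightarrow> degree d \<le> degree e"
    using arg_min_natI[of "\<lambda>d. d \<in> S" g degree] arg_min_nat_le[of "\<lambda>d. d \<in> S" _ degree] by blast
  then obtain v w where dvw: "d = v * f + w * g" and "d \<noteq> 0"
    unfolding S_def by auto
  have dvd: "d dvd v' * f + w' * g" for v' w'
  proof (rule ccontr)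
    let ?e = "v' * f + w' * g"
    assume "\<not> d dvd ?e"
    then have ne: "?e mod d \<noteq> 0"
      by (simp add: dvd_eq_mod_eq_0)
    have "?e mod d = ?e - (?e div d) * d"
      by (simp add: minus_div_mult_eq_mod)
    also have "\<dots> = (v' - (?e div d) * v) * f + (w' - (?e div d) * w) * g"
      by (subst (2) dvw) (simp add: algebra_simps)
    finally have "?e mod d \<in> S"
      unfolding S_def using ne by blast
    then have "degree d \<le> degree (?e mod d)"
      by (rule least)
    with degree_mod_less'[OF \<open>d \<noteq> 0\<close> ne] show False
      by simp
  qed
  have "d dvd f" "d dvd g"
    using dvd[of 1 0] dvd[of 0 1] by simp_all
  then have "is_unit d"
    using cop by (rule coprime_common_divisor[rotated])
  have "d * u = v * (f * u) + g * (w * u)"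
    unfolding dvw by (simp add: algebra_simps)
  then have "g dvd d * u"
    using \<open>g dvd f * u\<close> by simp
  with \<open>is_unit d\<close> show ?thesis
    by (simp add: dvd_mult_unit_iff')
qed

lemma lowest_terms_unique:
  fixes h :: "'a::field poly fract"
  assumes "lowest_terms h f g" "lowest_terms h f' g'"
  obtains c where "c \<noteq> 0" "f' = smult c f" "g' = smult c g"
proof -
  from assms have g: "g \<noteq> 0" "g' \<noteq> 0" and cop: "coprime f g" "coprime f' g'"
    and eq: "f * g' = f' * g"
    by (auto simp: lowest_terms_def eq_fract)
  have "g dvd g'"
    using coprime_poly_dvd_mult[OF cop(1) g(1)] eq by simp
  moreover have "g' dvd g"
    using coprime_poly_dvd_mult[OF cop(2) g(2), of g] eq[symmetric] by simp
  ultimately obtain u where u: "g' = g * u" "is_unit u"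
    using g by (metis dvdE dvd_times_left_cancel_iff mult.right_neutral)
  then obtain c where c: "u = [:c:]" "c \<noteq> 0"
    by (metis is_unit_poly_iff not_is_unit_0 pCons_0_0)
  have g': "g' = smult c g"
    using u c by simp
  have "f' * g = smult c f * g"
    using eq g' by simp
  then have "f' = smult c f"
    using g(1) by (simp only: mult_cancel_right) simp
  with c g' that show thesis
    by blast
qed

lemma ratfun_degree_eq:
  assumes "lowest_terms h f g"
  shows "ratfun_degree h = max (degree f) (degree g)"
  unfolding ratfun_degree_def
proof (rule the_equality)
  fix d
  assume "\<exists>f g. lowest_terms h f g \<and> d = max (degree f) (degree g)"
  then show "d = max (degree f) (degree g)"
    using lowest_terms_unique[OF assms] by (metis degree_smult_eq)
qed (use assms in blast)

lemma frac_eval_smult: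
  "c \<noteq> 0 \<Longrightarrow> frac_eval (smult c f) (smult c g) P = frac_eval f g P"
  by (simp add: frac_eval_def Let_def split: proj_line.splits)

lemma ratfun_eval_eq:
  assumes "lowest_terms h f g"
  shows "ratfun_eval h P = frac_eval f g P"
  unfolding ratfun_eval_def
proof (rule the_equality)
  fix Q
  assume "\<exists>f g. lowest_terms h f g \<and> Q = frac_eval f g P"
  then show "Q = frac_eval f g P"
    using lowest_terms_unique[OF assms] by (metis frac_eval_smult)
qed (use assms in blast)

definition good_family ::
    "nat \<Rightarrow> nat \<Rightarrow> 'a::field poly fract \<Rightarrow> (nat \<Rightarrow> 'a proj_line set) \<Rightarrow> (nat \<Rightarrow> 'a proj_line) \<Rightarrow> bool"
  where
  "good_family r l h A t \<longleftrightarrow>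
     disjoint_family_on A {1..l} \<and>
     (\<forall>i\<in>{1..l}. card (A i) = r + 1 \<and> ratfun_eval h ` A i = {t i})"

definition good_ratfun :: "nat \<Rightarrow> nat \<Rightarrow> 'a::field poly fract \<Rightarrow> bool" where
  "good_ratfun r l h \<longleftrightarrow>
     l \<ge> 1 \<and> ratfun_degree h = r + 1 \<and> (\<exists>A t. good_family r l h A t)"


section \<open>Locally recoverable codes\<close>

definition hamming_dist :: "'a ^ 'n \<Rightarrow> 'a ^ 'n \<Rightarrow> nat" where
  "hamming_dist c d = card {s. c $ s \<noteq> d $ s}"

definition min_distance :: "('a ^ 'n) set \<Rightarrow> nat" where
  "min_distance C = Min {hamming_dist c d | c d. c \<in> C \<and> d \<in> C \<and> c \<noteq> d}"

definition is_lrc :: "nat \<Rightarrow> nat \<Rightarrow> nat \<Rightarrow> ('a::field ^ 'n) set \<Rightarrow> bool" where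
  "is_lrc n k r C \<longleftrightarrow>
     CARD('n) = n \<and> vec.subspace C \<and> vec.dim C = k \<and>
     (\<forall>s. \<exists>I. s \<notin> I \<and> card I \<le> r \<and>
        (\<forall>c\<in>C. \<forall>d\<in>C. (\<forall>u\<in>I. c $ u = d $ u) \<longrightarrow> c $ s = d $ s))"

definition optimal_lrc :: "nat \<Rightarrow> nat \<Rightarrow> nat \<Rightarrow> ('a::field ^ 'n) set \<Rightarrow> bool" where
  "optimal_lrc n k r C \<longleftrightarrow>
     is_lrc n k r C \<and>
     int (min_distance C) = int n - int k - \<lceil>real k / real r\<rceil> + 2"


section \<open>The evaluation code\<close>

text \<open>
  The value of \<open>h\<^sub>a\<close> at a finite point. Its denominator does not vanish when \<open>f\<close>, \<open>g\<close> are coprime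
  and \<open>b\<close> is not a value of \<open>f / g\<close>. Only the entries \<open>a i j\<close> with \<open>i < r\<close> and \<open>j < k div r\<close> matter,
  so all functions \<open>a\<close> together represent all coefficient vectors of length \<open>k\<close>.
\<close>

definition message_fun ::
    "nat \<Rightarrow> nat \<Rightarrow> 'a::field poly \<Rightarrow> 'a poly \<Rightarrow> 'a \<Rightarrow> (nat \<Rightarrow> nat \<Rightarrow> 'a) \<Rightarrow> 'a \<Rightarrow> 'a" where
  "message_fun r k f g b a x =
     (\<Sum>i<r. \<Sum>j<k div r. a i j * (poly g x / (poly f x - b * poly g x)) ^ j * x ^ i)"

definition recip_shift :: "'a::field proj_line \<Rightarrow> 'a \<Rightarrow> 'a" where
  "recip_shift t b = (case t of Fin y \<Rightarrow> 1 / (y - b) | Infty \<Rightarrow> 0)"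

definition message_at_infinity ::
    "nat \<Rightarrow> nat \<Rightarrow> 'a::field proj_line \<Rightarrow> 'a \<Rightarrow> (nat \<Rightarrow> nat \<Rightarrow> 'a) \<Rightarrow> 'a" where
  "message_at_infinity r k t b a = (\<Sum>j<k div r. a (r - 1) j * recip_shift t b ^ j)"

end

theory Submission
  imports Defs
begin

text \<open>
  Put \<open>D = f - b g\<close>, which has degree \<open>r + 1\<close> and no zero on the projective line, and \<open>m = k / r\<close>.
  Multiplying \<open>h\<^sub>a\<close> by \<open>D ^ (m - 1)\<close> gives a polynomial of degree at most
  \<open>N = (r + 1) (m - 1) + r - 1\<close>, nonzero for \<open>a \<noteq> 0\<close> because \<open>g\<close> and \<open>D\<close> are coprime; read as a form
  of degree \<open>N\<close> it has at most \<open>N\<close> projective zeros, and the coordinate at infinity is its leading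
  coefficient up to a nonzero factor. This gives the dimension and the bound \<open>n - N = n - k - m + 2\<close>
  on the distance, which an explicit message attains, so the general upper bound on the distance of
  a locally recoverable code is not used. On each \<open>A\<^sub>i\<close> the fraction \<open>g / D\<close> is constant, hence \<open>h\<^sub>a\<close>
  is a form of degree \<open>r - 1\<close> there, determined by its values at \<open>r\<close> points.
\<close>

section \<open>Forms on the projective line and their zeros\<close>

text \<open>Evaluation of \<open>p\<close> as a form of degree \<open>N\<close>, normalized at infinity to the point \<open>(1 : 0)\<close>.\<close>

definition proj_eval :: "nat \<Rightarrow> 'a::comm_semiring_0 poly \<Rightarrow> 'a proj_line \<Rightarrow> 'a" where
  "proj_eval N p P = (case P of Fin x \<Rightarrow> poly p x | Infty \<Rightarrow> coeff p N)"

lemma proj_eval_simps [simp]: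
  "proj_eval N p (Fin x) = poly p x"
  "proj_eval N p Infty = coeff p N"
  by (simp_all add: proj_eval_def)

lemma proj_eval_0 [simp]: "proj_eval N 0 P = 0"
  by (cases P) simp_all

lemma proj_eval_smult [simp]: "proj_eval N (smult c p) P = c * proj_eval N p P"
  by (cases P) simp_all

lemma proj_eval_sum: "proj_eval N (\<Sum>i\<in>I. p i) P = (\<Sum>i\<in>I. proj_eval N (p i) P)"
  by (cases P) (simp_all add: poly_sum coeff_sum)

text \<open>In the convolution an index below \<open>M\<close> makes the index into \<open>q\<close>
  exceed \<open>N\<close>, and an index above \<open>M\<close> exceeds the degree of
  \<open>p\<close>.\<close>

lemma coeff_mult_top:
  fixes p q :: "'a::comm_semiring_0 poly"
  assumes "degree p \<le> M" "degree q \<le> N"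
  shows "coeff (p * q) (M + N) = coeff p M * coeff q N"
proof -
  have "coeff (p * q) (M + N) = (\<Sum>i\<le>M + N. coeff p i * coeff q (M + N - i))"
    by (rule coeff_mult)
  also have "\<dots> = (\<Sum>i\<in>{M}. coeff p i * coeff q (M + N - i))"
  proof (rule sum.mono_neutral_right)
    show "\<forall>i\<in>{..M + N} - {M}. coeff p i * coeff q (M + N - i) = 0"
    proof
      fix i assume i: "i \<in> {..M + N} - {M}"
      show "coeff p i * coeff q (M + N - i) = 0"
      proof (cases "i < M")
        case True
        then have "coeff q (M + N - i) = 0"
          using assms(2) by (intro coeff_eq_0) simp
        then show ?thesis by simp
      next
        case False
        then have "coeff p i = 0"
          using i assms(1) by (intro coeff_eq_0) simp
        then show ?thesis by simp
      qed
    qed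
  qed auto
  finally show ?thesis by simp
qed

lemma proj_eval_mult:
  assumes "degree p \<le> M" "degree q \<le> N"
  shows "proj_eval (M + N) (p * q) P = proj_eval M p P * proj_eval N q P"
  using coeff_mult_top[OF assms] by (cases P) simp_all

lemma proj_eval_power:
  fixes p :: "'a::comm_semiring_1 poly"
  assumes "degree p \<le> M"
  shows "proj_eval (M * j) (p ^ j) P = proj_eval M p P ^ j"
proof (induction j)
  case 0
  show ?case by (cases P) simp_all
next
  case (Suc j)
  have "degree (p ^ j) \<le> M * j"
    by (rule order_trans[OF degree_power_le mult_le_mono1[OF assms]])
  from proj_eval_mult[OF assms this] Suc show ?case
    by simp
qed

text \<open>A zero at infinity forces the degree below \<open>N\<close>, which pays for the extra
  point; otherwise only the roots count.\<close>

lemma card_proj_zeros: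
  fixes p :: "'a::field poly"
  assumes "p \<noteq> 0" "degree p \<le> N"
  shows "finite {P. proj_eval N p P = 0}" and "card {P. proj_eval N p P = 0} \<le> N"
proof -
  have eq: "{P. proj_eval N p P = 0} =
      Fin ` {x. poly p x = 0} \<union> (if coeff p N = 0 then {Infty} else {})"
  proof (rule set_eqI)
    fix P show "P \<in> {P. proj_eval N p P = 0} \<longleftrightarrow>
        P \<in> Fin ` {x. poly p x = 0} \<union> (if coeff p N = 0 then {Infty} else {})"
      by (cases P) auto
  qed
  have fin: "finite {x. poly p x = 0}"
    using assms(1) by (rule poly_roots_finite)
  then show "finite {P. proj_eval N p P = 0}"
    unfolding eq by simp
  have c: "card (Fin ` {x. poly p x = 0}) \<le> degree p"
    using card_image_le[OF fin, of Fin] card_poly_roots_bound[OF assms(1)] by linarith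
  show "card {P. proj_eval N p P = 0} \<le> N"
  proof (cases "coeff p N = 0")
    case True
    then have "degree p \<noteq> N"
      using assms(1) by auto
    then have "Suc (degree p) \<le> N"
      using assms(2) by simp
    then show ?thesis
      unfolding eq using True c fin by (simp add: card_insert_if)
  next
    case False
    then show ?thesis
      unfolding eq using c assms(2) by simp
  qed
qed

lemma poly_eq_0_if_proj_zeros:
  fixes p :: "'a::field poly"
  assumes "degree p \<le> N" "N < card S" "\<And>P. P \<in> S \<Longrightarrow> proj_eval N p P = 0"
  shows "p = 0"
proof (rule ccontr)
  assume p: "p \<noteq> 0"
  have "card S \<le> card {P. proj_eval N p P = 0}"
    using assms(3) by (intro card_mono card_proj_zeros[OF p assms(1)]) auto
  then show False
    using card_proj_zeros(2)[OF p assms(1)] assms(2) by simp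
qed

lemma degree_prod_linear:
  fixes c :: "'i \<Rightarrow> 'a::idom"
  shows "degree (\<Prod>i\<in>I. [:- c i, 1:]) = card I"
proof -
  have "degree (\<Prod>i\<in>I. [:- c i, 1:]) = (\<Sum>i\<in>I. degree [:- c i, 1:])"
    by (rule degree_prod_eq_sum_degree) simp
  then show ?thesis by simp
qed

text \<open>The product of the linear factors of the finite points works: if \<open>Infty\<close>
  lies in \<open>S\<close>, its degree is below \<open>N\<close>, so the coefficient at
  \<open>N\<close> vanishes.\<close>

lemma ex_poly_with_proj_zeros:
  fixes S :: "'a::field proj_line set"
  assumes "finite S" "card S \<le> N"
  obtains p where "p \<noteq> 0" "degree p \<le> N" "\<And>P. P \<in> S \<Longrightarrow> proj_eval N p P = 0"
proof -
  define X where "X = {x. Fin x \<in> S}"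
  define p where "p = (\<Prod>x\<in>X. [:- x, 1:])"
  have inj: "inj_on Fin X"
    by (auto intro: inj_onI)
  have img: "Fin ` X = S - {Infty}"
  proof (rule set_eqI)
    fix P show "P \<in> Fin ` X \<longleftrightarrow> P \<in> S - {Infty}"
      by (cases P) (auto simp: X_def)
  qed
  have finX: "finite X"
    using assms(1) finite_imageD[OF _ inj] by (simp add: img)
  have deg: "degree p = card (S - {Infty})"
    unfolding p_def degree_prod_linear img[symmetric] by (rule card_image[OF inj, symmetric])
  have le: "degree p \<le> N"
    using deg assms card_mono[of S "S - {Infty}"] by simp
  have "p \<noteq> 0"
    using finX by (simp add: p_def)
  moreover have "proj_eval N p P = 0" if "P \<in> S" for P
  proof (cases P)
    case (Fin x)
    then have "x \<in> X"
      using that by (simp add: X_def)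
    then show ?thesis
      using finX by (auto simp: Fin p_def poly_prod)
  next
    case Infty
    then have "degree p < N"
      using deg assms that card_Diff1_less[of S Infty] by simp
    then show ?thesis
      by (simp add: Infty coeff_eq_0)
  qed
  ultimately show thesis
    using that le by blast
qed

section \<open>Linear algebra: the code as a span\<close>

lemma dim_range_independent_family:
  fixes v :: "'i \<Rightarrow> 'a::field ^ 'n"
  assumes fin: "finite I"
    and ker: "\<And>a. (\<Sum>p\<in>I. a p *s v p) = 0 \<Longrightarrow> \<forall>p\<in>I. a p = 0"
  shows "vec.subspace (range (\<lambda>a. \<Sum>p\<in>I. a p *s v p))"
    and "vec.dim (range (\<lambda>a. \<Sum>p\<in>I. a p *s v p)) = card I"
proof -
  let ?L = "\<lambda>a. \<Sum>p\<in>I. a p *s v p"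
  have inj: "inj_on v I"
  proof (rule inj_onI, rule ccontr)
    fix p q assume pq: "p \<in> I" "q \<in> I" "v p = v q" "p \<noteq> q"
    \<comment> \<open>A repeated vector would give a nontrivial relation with coefficients
      \<open>1\<close> and \<open>- 1\<close>.\<close>
    let ?a = "\<lambda>x. if x = p then 1 else if x = q then - 1 else (0::'a)"
    have "?L ?a = (\<Sum>x\<in>{p, q}. ?a x *s v x)"
      using pq fin by (intro sum.mono_neutral_right) auto
    also have "\<dots> = 0"
      using pq by simp
    finally show False
      using ker[of ?a] pq by auto
  qed
  have indep: "vec.independent (v ` I)"
  proof (rule vec.independent_if_scalars_zero)
    show "finite (v ` I)" using fin by simp
    fix c x assume s: "(\<Sum>x\<in>v ` I. c x *s x) = 0" and x: "x \<in> v ` I"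
    have "?L (\<lambda>p. c (v p)) = 0"
      using s by (simp add: sum.reindex[OF inj])
    from ker[OF this] x show "c x = 0" by auto
  qed
  have span: "vec.span (v ` I) = range ?L"
  proof
    show "range ?L \<subseteq> vec.span (v ` I)"
      by (intro image_subsetI vec.span_sum vec.span_scale vec.span_base imageI)
    show "vec.span (v ` I) \<subseteq> range ?L"
    proof
      fix x assume "x \<in> vec.span (v ` I)"
      then obtain c where "x = (\<Sum>y\<in>v ` I. c y *s y)"
        using vec.span_finite[of "v ` I"] fin by auto
      then have "x = ?L (\<lambda>p. c (v p))"
        by (simp add: sum.reindex[OF inj])
      then show "x \<in> range ?L"
        using rangeI[of ?L "\<lambda>p. c (v p)"] by simp
    qed
  qed
  show "vec.subspace (range ?L)"
    unfolding span[symmetric] by (rule vec.subspace_span)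
  show "vec.dim (range ?L) = card I"
    unfolding span[symmetric] vec.dim_span
    using vec.dim_eq_card_independent[OF indep] card_image[OF inj] by simp
qed

section \<open>Coprime polynomials and homogeneous sums\<close>

text \<open>Euclid's lemma, cancelling one factor \<open>g\<close> at a time.\<close>

lemma dvd_if_dvd_power_mult:
  fixes g u d :: "'a::field poly"
  assumes "coprime g d" "d \<noteq> 0" "d dvd g ^ j * u"
  shows "d dvd u"
  using assms(3)
proof (induction j)
  case (Suc j)
  then have "d dvd g * (g ^ j * u)"
    by (simp add: mult.assoc)
  then show ?case
    using coprime_poly_dvd_mult[OF assms(1,2)] Suc.IH by blast
qed simp

text \<open>Reducing modulo \<open>d\<close> isolates the last summand; the others are divisible by \<open>d\<close>.\<close>

lemma homogeneous_sum_eq_0: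
  fixes g d :: "'a::field poly"
  assumes cop: "coprime g d" and deg: "\<And>j. degree (B j) < degree d"
    and "(\<Sum>j<m. B j * g ^ j * d ^ (m - 1 - j)) = 0" and "j < m"
  shows "B j = 0"
  using assms(3,4)
proof (induction m arbitrary: j)
  case (Suc m)
  have d0: "d \<noteq> 0"
    using deg[of 0] by auto
  let ?s = "\<Sum>j<m. B j * g ^ j * d ^ (m - 1 - j)"
  have "(\<Sum>j<m. B j * g ^ j * d ^ (m - j)) = d * ?s"
    unfolding sum_distrib_left
  proof (rule sum.cong[OF refl])
    fix j assume "j \<in> {..<m}"
    then have "m - j = Suc (m - 1 - j)" by auto
    then show "B j * g ^ j * d ^ (m - j) = d * (B j * g ^ j * d ^ (m - 1 - j))"
      by (simp add: ac_simps)
  qed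
  with Suc.prems(1) have eq: "d * ?s + B m * g ^ m = 0"
    by simp
  then have "g ^ m * B m = d * (- ?s)"
    by (simp add: algebra_simps add_eq_0_iff2)
  then have "d dvd g ^ m * B m"
    by (simp only: dvd_triv_left)
  then have "d dvd B m"
    by (rule dvd_if_dvd_power_mult[OF cop d0])
  then have Bm: "B m = 0"
    using deg[of m] dvd_imp_degree_le not_less by blast
  with eq d0 have "?s = 0" by simp
  with Suc.IH Bm Suc.prems(2) show ?case
    by (cases "j = m") auto
qed simp

section \<open>The evaluation code attached to \<open>f / g\<close>\<close>

text \<open>\<open>m\<close> stands for \<open>k div r\<close>. The range in
  \<open>b_not_value\<close> includes the value at infinity, which forces \<open>D\<close> to have
  full degree \<open>r + 1\<close>.\<close>

locale lrc_evaluation =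
  fixes f g :: "'a::field poly" and b :: 'a and r m :: nat
  assumes r_pos: "r \<ge> 1" and m_pos: "m \<ge> 1"
    and degree_max: "max (degree f) (degree g) = r + 1"
    and coprime_fg: "coprime f g"
    and b_not_value: "Fin b \<notin> range (frac_eval f g)"
begin

definition D :: "'a poly" where
  "D = f - smult b g"

text \<open>The function \<open>g / D\<close>, phrased through the value of \<open>f / g\<close> so
  that it is visibly constant on fibres and defined at infinity.\<close>

definition u :: "'a proj_line \<Rightarrow> 'a" where
  "u P = recip_shift (frac_eval f g P) b"

text \<open>Covers both kinds of coordinate: at \<open>Infty\<close> the monomial, read as a form of
  degree \<open>r - 1\<close>, is \<open>1\<close> for \<open>i = r - 1\<close> and \<open>0\<close>
  for smaller \<open>i\<close>.\<close>

definition message :: "(nat \<Rightarrow> nat \<Rightarrow> 'a) \<Rightarrow> 'a proj_line \<Rightarrow> 'a" where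
  "message a P = (\<Sum>i<r. \<Sum>j<m. a i j * (u P ^ j * proj_eval (r - 1) (monom 1 i) P))"

text \<open>The numerator of the message function over the common denominator
  \<open>D ^ (m - 1)\<close>.\<close>

definition cleared :: "(nat \<Rightarrow> nat \<Rightarrow> 'a) \<Rightarrow> 'a poly" where
  "cleared a = (\<Sum>i<r. \<Sum>j<m. smult (a i j) (monom 1 i * (g ^ j * D ^ (m - 1 - j))))"

lemma degree_g_le: "degree g \<le> r + 1" and degree_f_le: "degree f \<le> r + 1"
  using degree_max by auto

lemma degree_D_le: "degree D \<le> r + 1"
  unfolding D_def using degree_g_le degree_f_le degree_smult_le[of b g]
  by (intro degree_diff_le) auto

text \<open>\<open>f\<close> and \<open>g\<close> have no common projective zero. Where
  \<open>g\<close> vanishes, \<open>D\<close> agrees with \<open>f\<close> and both sides of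
  \<open>u_eq\<close> are \<open>0\<close>; elsewhere a zero of \<open>D\<close> would make
  \<open>b\<close> a value.\<close>

lemma proj_eval_D_nonzero: "proj_eval (r + 1) D P \<noteq> 0"
  and u_eq: "u P = proj_eval (r + 1) g P / proj_eval (r + 1) D P"
proof -
  have nb: "frac_eval f g P \<noteq> Fin b"
    using b_not_value by (metis rangeI)
  have "proj_eval (r + 1) D P \<noteq> 0 \<and> u P = proj_eval (r + 1) g P / proj_eval (r + 1) D P"
  proof (cases P)
    case (Fin x)
    have "\<not> (poly f x = 0 \<and> poly g x = 0)"
    proof
      assume "poly f x = 0 \<and> poly g x = 0"
      then have "[:- x, 1:] dvd f" "[:- x, 1:] dvd g"
        by (simp_all add: poly_eq_0_iff_dvd)
      then have "is_unit [:- x, 1:]"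
        using coprime_fg coprime_common_divisor by blast
      then show False
        by (simp add: is_unit_iff_degree)
    qed
    then show ?thesis
      using nb by (auto simp: Fin D_def u_def frac_eval_def recip_shift_def divide_simps split: if_splits)
  next
    case Infty
    \<comment> \<open>At infinity a common zero is excluded by \<open>degree_max\<close>: one of the
      two coefficients is a leading coefficient.\<close>
    have "\<not> (coeff f (r + 1) = 0 \<and> coeff g (r + 1) = 0)"
    proof
      assume "coeff f (r + 1) = 0 \<and> coeff g (r + 1) = 0"
      moreover have "degree f = r + 1 \<or> degree g = r + 1"
        using degree_max by (auto simp: max_def split: if_splits)
      ultimately have "f = 0 \<and> degree g \<le> r + 1 \<or> g = 0"
        by (metis leading_coeff_0_iff degree_g_le)
      then show False
        using \<open>degree f = r + 1 \<or> degree g = r + 1\<close> \<open>coeff f (r + 1) = 0 \<and> coeff g (r + 1) = 0\<close>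
        by (metis Suc_eq_plus1 degree_0 leading_coeff_0_iff nat.distinct(1))
    qed
    then show ?thesis
      using nb by (auto simp: Infty D_def u_def frac_eval_def recip_shift_def degree_max[simplified]
          Let_def divide_simps split: if_splits)
  qed
  then show "proj_eval (r + 1) D P \<noteq> 0"
    and "u P = proj_eval (r + 1) g P / proj_eval (r + 1) D P"
    by blast+
qed

lemma degree_D: "degree D = r + 1"
  using proj_eval_D_nonzero[of Infty] degree_D_le le_degree[of D "r + 1"] by simp

lemma coprime_g_D: "coprime g D"
proof (rule coprimeI)
  fix c assume c: "c dvd g" "c dvd D"
  then have "c dvd D + smult b g"
    by (intro dvd_add dvd_smult)
  then have "c dvd f"
    by (simp add: D_def)
  with c(1) coprime_fg show "is_unit c"
    using coprime_common_divisor by blast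
qed

text \<open>Pointwise \<open>g\<close> is \<open>u\<close> times \<open>D\<close>, so
  \<open>g ^ j * D ^ (m - 1 - j)\<close> takes the values of \<open>D ^ (m - 1) * u ^ j\<close>,
  with a degree bound independent of \<open>j\<close>.\<close>

lemma cleared_summand:
  assumes "i < r" "j < m"
  shows "degree (monom (1::'a) i) \<le> r - 1"
    and "degree (g ^ j * D ^ (m - 1 - j)) \<le> (r + 1) * (m - 1)"
    and "proj_eval ((r + 1) * (m - 1)) (g ^ j * D ^ (m - 1 - j)) P =
      proj_eval (r + 1) D P ^ (m - 1) * u P ^ j"
proof -
  show "degree (monom (1::'a) i) \<le> r - 1"
    using assms(1) by (simp add: degree_monom_eq)
  have N: "(r + 1) * (m - 1) = (r + 1) * j + (r + 1) * (m - 1 - j)"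
    unfolding distrib_left[symmetric] using assms(2) by (intro arg_cong[of _ _ "(*) (r + 1)"]) simp
  have deg: "degree (g ^ j) \<le> (r + 1) * j" "degree (D ^ (m - 1 - j)) \<le> (r + 1) * (m - 1 - j)"
    using degree_power_le[of g j] mult_le_mono1[OF degree_g_le, of j]
      degree_power_le[of D "m - 1 - j"] mult_le_mono1[OF degree_D_le, of "m - 1 - j"]
    by linarith+
  show "degree (g ^ j * D ^ (m - 1 - j)) \<le> (r + 1) * (m - 1)"
    using degree_mult_le[of "g ^ j" "D ^ (m - 1 - j)"] deg unfolding N by linarith
  have "proj_eval ((r + 1) * (m - 1)) (g ^ j * D ^ (m - 1 - j)) P =
      proj_eval (r + 1) g P ^ j * proj_eval (r + 1) D P ^ (m - 1 - j)"
    unfolding N using proj_eval_mult[OF deg] proj_eval_power[OF degree_g_le]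
      proj_eval_power[OF degree_D_le] by simp
  also have "proj_eval (r + 1) g P = u P * proj_eval (r + 1) D P"
    using u_eq[of P] proj_eval_D_nonzero[of P] by simp
  also have "(u P * proj_eval (r + 1) D P) ^ j * proj_eval (r + 1) D P ^ (m - 1 - j) =
      u P ^ j * proj_eval (r + 1) D P ^ (j + (m - 1 - j))"
    by (simp add: power_mult_distrib power_add mult.assoc)
  also have "j + (m - 1 - j) = m - 1"
    using assms(2) by simp
  finally show "proj_eval ((r + 1) * (m - 1)) (g ^ j * D ^ (m - 1 - j)) P =
      proj_eval (r + 1) D P ^ (m - 1) * u P ^ j"
    by (simp add: mult.commute)
qed

lemma degree_cleared: "degree (cleared a) \<le> r - 1 + (r + 1) * (m - 1)"
  unfolding cleared_def
proof (intro degree_sum_le)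
  fix i j assume "i \<in> {..<r}" "j \<in> {..<m}"
  then have "i < r" "j < m" by auto
  from cleared_summand(1,2)[OF this]
  show "degree (smult (a i j) (monom 1 i * (g ^ j * D ^ (m - 1 - j)))) \<le>
      r - 1 + (r + 1) * (m - 1)"
    using degree_smult_le degree_mult_le add_mono order_trans by meson
qed auto

text \<open>Since \<open>D\<close> vanishes nowhere, \<open>message a\<close> and the form
  \<open>cleared a\<close> have the same zeros.\<close>

lemma proj_eval_cleared:
  "proj_eval (r - 1 + (r + 1) * (m - 1)) (cleared a) P =
    proj_eval (r + 1) D P ^ (m - 1) * message a P"
  unfolding cleared_def message_def proj_eval_sum sum_distrib_left
proof (intro sum.cong refl)
  fix i j assume "i \<in> {..<r}" "j \<in> {..<m}"
  then have ij: "i < r" "j < m" by auto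
  show "proj_eval (r - 1 + (r + 1) * (m - 1))
      (smult (a i j) (monom 1 i * (g ^ j * D ^ (m - 1 - j)))) P =
    proj_eval (r + 1) D P ^ (m - 1) * (a i j * (u P ^ j * proj_eval (r - 1) (monom 1 i) P))"
    unfolding proj_eval_smult proj_eval_mult[OF cleared_summand(1,2)[OF ij]]
      cleared_summand(3)[OF ij]
    by (simp add: ac_simps)
qed

text \<open>Collecting by powers of \<open>g\<close> gives a homogeneous sum in \<open>g\<close> and
  \<open>D\<close> whose coefficients have degree at most \<open>r - 1\<close>, below that of
  \<open>D\<close>.\<close>

lemma cleared_eq_0_imp:
  assumes "cleared a = 0" "i < r" "j < m"
  shows "a i j = 0"
proof -
  define B where "B j = (\<Sum>i<r. monom (a i j) i)" for j
  have "cleared a = (\<Sum>j<m. B j * g ^ j * D ^ (m - 1 - j))"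
    unfolding cleared_def B_def
    by (subst sum.swap) (simp add: sum_distrib_right smult_monom mult.assoc flip: mult_smult_left)
  moreover have "degree (B j) < degree D" for j
  proof -
    have "degree (B j) \<le> r - 1"
      unfolding B_def
      by (intro degree_sum_le) (auto intro: order_trans[OF degree_monom_le])
    then show ?thesis
      using degree_D by simp
  qed
  ultimately have "B j = 0"
    using homogeneous_sum_eq_0[OF coprime_g_D, of B m j] assms(1,3) by simp
  moreover have "coeff (B j) i = a i j"
    using assms(2) by (simp add: B_def coeff_sum)
  ultimately show ?thesis by simp
qed

lemma message_diff: "message (\<lambda>i j. a i j - a' i j) P = message a P - message a' P"
  by (simp add: message_def left_diff_distrib sum_subtractf)

text \<open>The cleared form would have more zeros than its degree allows. Both the dimension and
  the lower bound on the distance rest on this.\<close>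

lemma message_coeff_eq_0_if_zeros:
  assumes "\<And>P. P \<in> S \<Longrightarrow> message a P = 0"
    and "r - 1 + (r + 1) * (m - 1) < card S" and "i < r" "j < m"
  shows "a i j = 0"
proof (rule cleared_eq_0_imp[OF _ assms(3,4)])
  show "cleared a = 0"
    by (rule poly_eq_0_if_proj_zeros[OF degree_cleared assms(2)])
      (simp only: proj_eval_cleared assms(1) mult_zero_right)
qed

text \<open>With \<open>u\<close> fixed at \<open>\<tau>\<close>, the message is a form of degree
  \<open>r - 1\<close> in the point, which \<open>r\<close> zeros annihilate. Applied to a
  difference of messages, this is local recovery.\<close>

lemma message_vanishes_on_fibre:
  assumes "\<And>P. P \<in> insert Q S \<Longrightarrow> u P = \<tau>" "\<And>P. P \<in> S \<Longrightarrow> message a P = 0" "r \<le> card S"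
  shows "message a Q = 0"
proof -
  define p where "p = (\<Sum>i<r. \<Sum>j<m. smult (a i j * \<tau> ^ j) (monom 1 i))"
  have ev: "proj_eval (r - 1) p P = message a P" if "P \<in> insert Q S" for P
    unfolding p_def message_def proj_eval_sum
    by (simp add: assms(1)[OF that] mult.assoc del: insert_iff)
  have "degree p \<le> r - 1"
    unfolding p_def
    by (intro degree_sum_le)
      (auto intro!: order_trans[OF degree_smult_le] order_trans[OF degree_monom_le])
  moreover have "r - 1 < card S"
    using assms(3) r_pos by simp
  ultimately have "p = 0"
    by (rule poly_eq_0_if_proj_zeros) (use ev assms(2) in auto)
  then show ?thesis
    using ev[of Q] by simp
qed

section \<open>Messages attaining the distance\<close>

text \<open>For a product matrix of coefficients the double sum factors, so zeros can be prescribed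
  on whole fibres through \<open>e\<close> and at single points through \<open>p\<close>.\<close>

lemma message_rank_one:
  assumes "degree p < r" "degree e < m"
  shows "message (\<lambda>i j. coeff p i * coeff e j) P = poly e (u P) * proj_eval (r - 1) p P"
proof -
  have e: "poly e (u P) = (\<Sum>j<m. coeff e j * u P ^ j)"
    unfolding poly_altdef using assms(2)
    by (intro sum.mono_neutral_left) (auto simp: coeff_eq_0)
  have "p = (\<Sum>i<r. smult (coeff p i) (monom 1 i))"
    using assms(1) by (intro poly_eqI) (auto simp: coeff_sum coeff_eq_0 if_distrib cong: if_cong)
  then have p: "proj_eval (r - 1) p P = (\<Sum>i<r. coeff p i * proj_eval (r - 1) (monom 1 i) P)"
    by (metis (no_types, lifting) proj_eval_smult proj_eval_sum sum.cong)
  show ?thesis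
    unfolding e p message_def sum_product
    by (subst sum.swap) (simp add: ac_simps)
qed

text \<open>
  The word \<open>(\<Prod>i. u - \<tau> i) * p\<close> vanishes on \<open>m - 1\<close> whole fibres and at \<open>r - 1\<close> further points,
  which is as often as a nonzero message can vanish.
\<close>

lemma ex_message_with_many_zeros:
  assumes "\<And>i P. i \<in> {1..<m} \<Longrightarrow> P \<in> A i \<Longrightarrow> u P = \<tau> i" "finite S" "card S \<le> r - 1"
  shows "\<exists>a. (\<exists>i<r. \<exists>j<m. a i j \<noteq> 0) \<and>
    (\<forall>P\<in>(\<Union>i\<in>{1..<m}. A i) \<union> S. message a P = 0)"
proof -
  obtain p where p: "p \<noteq> 0" "degree p \<le> r - 1" "\<And>P. P \<in> S \<Longrightarrow> proj_eval (r - 1) p P = 0"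
    using ex_poly_with_proj_zeros[OF assms(2,3)] by blast
  define e where "e = (\<Prod>i\<in>{1..<m}. [:- \<tau> i, 1:])"
  have e: "e \<noteq> 0" "degree e < m"
    using m_pos by (auto simp: e_def degree_prod_linear)
  have pr: "degree p < r"
    using p(2) r_pos by simp
  let ?a = "\<lambda>i j. coeff p i * coeff e j"
  have "poly e (u P) = 0" if "P \<in> A i" "i \<in> {1..<m}" for i P
    using that assms(1)[OF that(2,1)] unfolding e_def poly_prod
    by (intro prod_zero) (auto intro!: bexI[of _ i])
  then have "message ?a P = 0" if "P \<in> (\<Union>i\<in>{1..<m}. A i) \<union> S" for P
    using that p(3) unfolding message_rank_one[OF pr e(2)] by auto
  \<comment> \<open>The product of the leading coefficients of \<open>p\<close> and \<open>e\<close>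
    is a nonzero entry.\<close>
  moreover have "\<exists>i<r. \<exists>j<m. ?a i j \<noteq> 0"
    using pr e p(1) by (intro exI[of _ "degree p"] exI[of _ "degree e"] conjI) simp_all
  ultimately show ?thesis
    by (intro exI[of _ ?a] conjI ballI)
qed

end

section \<open>Dimension, locality and distance of the code\<close>

theorem theorem3p2:
  fixes f g :: "'a::{field,finite} poly"
    and h :: "'a poly fract"
    and b :: 'a
    and r l k :: nat
    and A :: "nat \<Rightarrow> 'a proj_line set"
    and t :: "nat \<Rightarrow> 'a proj_line"
    and pt :: "'n::finite \<Rightarrow> 'a proj_line"
    and C :: "('a ^ 'n) set"
  assumes "r \<ge> 1" "l \<ge> 1" "k \<ge> 1"
    and "r dvd k" "k div r \<le> l"
    and "g \<noteq> 0" "coprime f g" "h = Fract f g"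
    and "good_ratfun r l h"
    and "good_family r l h A t"
    and "Fin b \<notin> range (ratfun_eval h)"
    and "bij_betw pt UNIV (\<Union>i\<in>{1..l}. A i)"
    and "Infty \<notin> (\<Union>i\<in>{1..l}. A i) \<Longrightarrow>
      C = {c. \<exists>a. \<forall>s x. pt s = Fin x \<longrightarrow> c $ s = message_fun r k f g b a x}"
    and "\<And>e. e \<in> {1..l} \<Longrightarrow> Infty \<in> A e \<Longrightarrow>
      C = {c. \<exists>a. (\<forall>s x. pt s = Fin x \<longrightarrow> c $ s = message_fun r k f g b a x) \<and>
                  (\<forall>s. pt s = Infty \<longrightarrow> c $ s = message_at_infinity r k (t e) b a)}"
  shows "optimal_lrc ((r + 1) * l) k r C"
proof -
  define m where "m = k div r"
  have km: "k = r * m"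
    using assms(4) by (simp add: m_def)
  have m1: "m \<ge> 1"
    using km assms(3) by (cases m) auto
  have ml: "m \<le> l"
    using assms(5) by (simp add: m_def)
  have low: "lowest_terms h f g"
    using assms(6-8) by (simp add: lowest_terms_def)
  have ev: "ratfun_eval h = frac_eval f g"
    using ratfun_eval_eq[OF low] by blast
  interpret lrc_evaluation f g b r m
    using assms(1,7,9,11) m1 ratfun_degree_eq[OF low]
    by unfold_locales (simp_all add: good_ratfun_def ev)

  have disj: "disjoint_family_on A {1..l}"
    and card_A: "\<And>i. i \<in> {1..l} \<Longrightarrow> card (A i) = r + 1"
    and h_A: "\<And>i. i \<in> {1..l} \<Longrightarrow> frac_eval f g ` A i = {t i}"
    using assms(10) unfolding good_family_def ev by blast+
  have u_A: "u P = recip_shift (t i) b" if "i \<in> {1..l}" "P \<in> A i" for i P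
    using imageI[OF that(2), of "frac_eval f g"] h_A[OF that(1)] by (simp add: u_def)
  have fin_A: "finite (A i)" if "i \<in> {1..l}" for i
    using card_A[OF that] by (intro card_ge_0_finite) simp
  have card_UN: "card (\<Union>i\<in>I. A i) = (r + 1) * card I" if "I \<subseteq> {1..l}" for I
  proof -
    have "card (\<Union>i\<in>I. A i) = (\<Sum>i\<in>I. card (A i))"
      using that disj fin_A finite_subset[OF that]
      by (intro card_UN_disjoint') (auto intro: disjoint_family_on_mono)
    also have "\<dots> = (\<Sum>i\<in>I. r + 1)"
      using that card_A by (intro sum.cong) auto
    finally show ?thesis by simp
  qed
  have inj_pt: "inj pt"
    using assms(12) by (simp add: bij_betw_def)
  have range_pt: "range pt = (\<Union>i\<in>{1..l}. A i)"
    using assms(12) by (simp add: bij_betw_def)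
  have card_n: "CARD('n) = (r + 1) * l"
    using bij_betw_same_card[OF assms(12)] card_UN[of "{1..l}"] by simp
  \<comment> \<open>Positions can be counted as points, because \<open>pt\<close> is injective and
    \<open>S\<close> lies in its range.\<close>
  have card_pt: "card {s. pt s \<in> S} = card S" if "S \<subseteq> (\<Union>i\<in>{1..l}. A i)" for S
    using that inj_pt card_vimage_inj[of pt S] by (simp add: range_pt vimage_def)

  have msg_Fin: "message_fun r k f g b a x = message a (Fin x)" for a x
    using u_eq[of "Fin x"]
    by (simp add: message_fun_def message_def m_def[symmetric] D_def poly_monom mult.assoc)
  have msg_Infty: "message_at_infinity r k (t e) b a = message a Infty"
    if "e \<in> {1..l}" "Infty \<in> A e" for a e
  proof -
    have "message a Infty = (\<Sum>i<r. \<Sum>j<m. if i = r - 1 then a i j * u Infty ^ j else 0)"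
      unfolding message_def by (intro sum.cong) auto
    also have "\<dots> = (\<Sum>j<m. a (r - 1) j * u Infty ^ j)"
      using r_pos by (subst sum.swap) simp
    finally show ?thesis
      using u_A[OF that] by (simp add: message_at_infinity_def m_def[symmetric])
  qed

  \<comment> \<open>One encoding map covers both cases of the definition of
    \<open>C\<close>.\<close>
  define word where "word a = (\<chi> s. message a (pt s))" for a
  have eq_word: "c = word a \<longleftrightarrow> (\<forall>s x. pt s = Fin x \<longrightarrow> c $ s = message a (Fin x)) \<and>
      (\<forall>s. pt s = Infty \<longrightarrow> c $ s = message a Infty)" for c a
  proof -
    have "c $ s = message a (pt s) \<longleftrightarrow> (\<forall>x. pt s = Fin x \<longrightarrow> c $ s = message a (Fin x)) \<and>
        (pt s = Infty \<longrightarrow> c $ s = message a Infty)" for s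
      by (cases "pt s") simp_all
    then show ?thesis
      by (simp add: word_def vec_eq_iff) blast
  qed
  have C: "C = range word"
  proof (cases "Infty \<in> (\<Union>i\<in>{1..l}. A i)")
    case False
    have "pt s \<noteq> Infty" for s
      using False range_pt rangeI[of pt s] by auto
    then have "(\<forall>s x. pt s = Fin x \<longrightarrow> c $ s = message_fun r k f g b a x) \<longleftrightarrow> c = word a" for c a
      unfolding msg_Fin eq_word by blast
    then show ?thesis
      using assms(13)[OF False] by auto
  next
    case True
    then obtain e where e: "e \<in> {1..l}" "Infty \<in> A e" by blast
    have "((\<forall>s x. pt s = Fin x \<longrightarrow> c $ s = message_fun r k f g b a x) \<and>
        (\<forall>s. pt s = Infty \<longrightarrow> c $ s = message_at_infinity r k (t e) b a)) \<longleftrightarrow> c = word a" for c a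
      unfolding msg_Fin msg_Infty[OF e] eq_word by blast
    then show ?thesis
      using assms(14)[OF e] by auto
  qed

  let ?N = "r - 1 + (r + 1) * (m - 1)"
  \<comment> \<open>As \<open>k = r * m\<close>, this says that \<open>?N\<close> is
    \<open>k + m - 2\<close>; adding \<open>2\<close> avoids truncated subtraction.\<close>
  have N_eq: "?N + 2 = (r + 1) * m"
    using m1 r_pos by (cases m) simp_all
  have N_less: "?N + 2 \<le> (r + 1) * l"
    unfolding N_eq using ml by (rule mult_le_mono2)
  \<comment> \<open>A zero word vanishes at all \<open>(r + 1) * l\<close> points, more than the
    \<open>?N\<close> zeros possible for a nonzero message.\<close>
  have inj_word: "a i j = 0" if "word a = 0" "i < r" "j < m" for a i j
  proof (rule message_coeff_eq_0_if_zeros[OF _ _ that(2,3)])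
    show "message a P = 0" if "P \<in> range pt" for P
      using that \<open>word a = 0\<close> by (auto simp: word_def vec_eq_iff)
    show "?N < card (range pt)"
      using N_less card_n inj_pt by (simp add: card_image)
  qed

  \<comment> \<open>The rows of a generator matrix, indexed by the pairs
    \<open>(i, j)\<close>.\<close>
  define v where "v = (\<lambda>(i, j). \<chi> s. u (pt s) ^ j * proj_eval (r - 1) (monom 1 i) (pt s))"
  let ?I = "{..<r} \<times> {..<m}"
  have word_v: "word (\<lambda>i j. a (i, j)) = (\<Sum>p\<in>?I. a p *s v p)" for a
    by (simp add: vec_eq_iff word_def message_def v_def sum.cartesian_product case_prod_unfold)
  have C_v: "C = range (\<lambda>a. \<Sum>p\<in>?I. a p *s v p)"
  proof -
    have "range word = range (\<lambda>a. word (\<lambda>i j. a (i, j)))"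
    proof
      show "range word \<subseteq> range (\<lambda>a. word (\<lambda>i j. a (i, j)))"
      proof
        fix c assume "c \<in> range word"
        then obtain a where "c = word a" by blast
        then have "c = (\<lambda>a. word (\<lambda>i j. a (i, j))) (\<lambda>(i, j). a i j)" by simp
        then show "c \<in> range (\<lambda>a. word (\<lambda>i j. a (i, j)))" by blast
      qed
    qed auto
    then show ?thesis
      unfolding C word_v .
  qed
  have ker_v: "\<forall>p\<in>?I. a p = 0" if "(\<Sum>p\<in>?I. a p *s v p) = 0" for a
    using inj_word[of "\<lambda>i j. a (i, j)"] that by (auto simp: word_v)
  have "vec.subspace C" "vec.dim C = k"
    using dim_range_independent_family[of ?I v] ker_v unfolding C_v
    by (auto simp: km card_cartesian_product)
  moreover have "\<exists>I. s \<notin> I \<and> card I \<le> r \<and>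
      (\<forall>c\<in>C. \<forall>d\<in>C. (\<forall>u\<in>I. c $ u = d $ u) \<longrightarrow> c $ s = d $ s)" for s
  proof -
    obtain i where i: "i \<in> {1..l}" "pt s \<in> A i"
      using range_pt by (metis UN_E rangeI)
    \<comment> \<open>The recovery set of \<open>s\<close> consists of the other \<open>r\<close>
      positions in its block \<open>A i\<close>.\<close>
    let ?S = "A i - {pt s}"
    let ?I = "{s'. pt s' \<in> ?S}"
    have card_S: "card ?S = r"
      using card_A[OF i(1)] fin_A[OF i(1)] i(2) by simp
    have sub: "?S \<subseteq> (\<Union>i\<in>{1..l}. A i)"
      using i by blast
    have "c $ s = d $ s" if cd: "c \<in> C" "d \<in> C" and eq: "\<forall>s'\<in>?I. c $ s' = d $ s'" for c d
    proof -
      obtain a a' where a: "c = word a" "d = word a'"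
        using cd unfolding C by auto
      have "message (\<lambda>i j. a i j - a' i j) (pt s) = 0"
      proof (rule message_vanishes_on_fibre)
        show "u P = recip_shift (t i) b" if "P \<in> insert (pt s) ?S" for P
          using that i(2) by (intro u_A[OF i(1)]) auto
        show "message (\<lambda>i j. a i j - a' i j) P = 0" if "P \<in> ?S" for P
        proof -
          have "P \<in> range pt"
            using that sub unfolding range_pt by (rule subsetD[rotated])
          then obtain s' where "P = pt s'"
            by (rule rangeE)
          moreover from this have "c $ s' = d $ s'"
            using that by (intro bspec[OF eq]) simp
          ultimately show ?thesis
            by (simp add: a word_def message_diff)
        qed
      qed (simp add: card_S)
      then show ?thesis
        by (simp add: a word_def message_diff)
    qed
    moreover have "s \<notin> ?I" "card ?I \<le> r"
      using card_pt[OF sub] card_S by simp_all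
    ultimately show ?thesis
      by (intro exI[of _ ?I] conjI ballI impI)
  qed
  ultimately have lrc: "is_lrc ((r + 1) * l) k r C"
    using card_n by (auto simp: is_lrc_def)

  \<comment> \<open>By \<open>N_less\<close> this subtraction is not truncated.\<close>
  let ?d = "(r + 1) * l - ?N"
  have card_compl: "card {s. message a (pt s) \<noteq> 0} = (r + 1) * l - card {s. message a (pt s) = 0}"
    for a
  proof -
    have "{s. message a (pt s) \<noteq> 0} = UNIV - {s. message a (pt s) = 0}" by auto
    then show ?thesis
      using card_n by (simp add: card_Diff_subset)
  qed
  have dist: "hamming_dist (word a) (word a') = card {s. message (\<lambda>i j. a i j - a' i j) (pt s) \<noteq> 0}"
    for a a'
    by (simp add: hamming_dist_def word_def message_diff)
  have lower: "?d \<le> card {s. message a (pt s) \<noteq> 0}" if "word a \<noteq> 0" for a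
  proof -
    have "card {s. message a (pt s) = 0} \<le> ?N"
    proof (rule ccontr)
      assume "\<not> card {s. message a (pt s) = 0} \<le> ?N"
      then have "?N < card (pt ` {s. message a (pt s) = 0})"
        by (simp add: card_image[OF inj_on_subset[OF inj_pt subset_UNIV]])
      then have "a i j = 0" if "i < r" "j < m" for i j
        by (rule message_coeff_eq_0_if_zeros[rotated, OF _ that]) auto
      then have "word a = 0"
        by (simp add: word_def message_def vec_eq_iff)
      with that show False by contradiction
    qed
    then show ?thesis
      unfolding card_compl by simp
  qed
  have "min_distance C = ?d"
    unfolding min_distance_def
  proof (rule Min_eqI)
    show "finite {hamming_dist c d |c d. c \<in> C \<and> d \<in> C \<and> c \<noteq> d}"
      by (rule finite_subset[of _ "{..CARD('n)}"]) (auto simp: hamming_dist_def intro: card_mono)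
  next
    fix y assume "y \<in> {hamming_dist c d |c d. c \<in> C \<and> d \<in> C \<and> c \<noteq> d}"
    then obtain a a' where y: "y = hamming_dist (word a) (word a')" "word a \<noteq> word a'"
      unfolding C by blast
    then have "word (\<lambda>i j. a i j - a' i j) \<noteq> 0"
      by (simp add: word_def message_diff vec_eq_iff)
    then show "?d \<le> y"
      unfolding y(1) dist by (rule lower)
  next
    have m_in: "m \<in> {1..l}"
      using m1 ml by simp
    \<comment> \<open>The \<open>m - 1\<close> blocks before \<open>A m\<close> and
      \<open>r - 1\<close> points of \<open>A m\<close> give exactly \<open>?N\<close> zeros; the
      block \<open>A m\<close> exists because \<open>m \<le> l\<close>.\<close>
    obtain S where S: "S \<subseteq> A m" "card S = r - 1" "finite S"
    proof (rule obtain_subset_with_card_n[of "r - 1" "A m"])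
      show "r - 1 \<le> card (A m)"
        using card_A[OF m_in] by simp
    qed
    have sub: "{1..<m} \<subseteq> {1..l}"
      using ml by auto
    have "u P = recip_shift (t i) b" if "i \<in> {1..<m}" "P \<in> A i" for i P
      using that sub by (intro u_A) auto
    moreover have "card S \<le> r - 1"
      using S(2) by simp
    ultimately obtain a where nz: "\<exists>i<r. \<exists>j<m. a i j \<noteq> 0"
      and zero: "\<forall>P\<in>(\<Union>i\<in>{1..<m}. A i) \<union> S. message a P = 0"
      using ex_message_with_many_zeros[of A "\<lambda>i. recip_shift (t i) b" S] S(3) by auto
    let ?Z = "(\<Union>i\<in>{1..<m}. A i) \<union> S"
    have "A i \<inter> A m = {}" if "i \<in> {1..<m}" for i
      using disj that ml unfolding disjoint_family_on_def by auto
    then have "(\<Union>i\<in>{1..<m}. A i) \<inter> S = {}"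
      using S(1) by blast
    then have "card ?Z = ?N"
      using card_UN[OF sub] S fin_A sub by (subst card_Un_disjoint) auto
    moreover have "?Z \<subseteq> (\<Union>i\<in>{1..l}. A i)"
      using sub m_in S(1) by blast
    ultimately have "card {s. pt s \<in> ?Z} = ?N"
      using card_pt by metis
    moreover have "card {s. pt s \<in> ?Z} \<le> card {s. message a (pt s) = 0}"
      using zero by (intro card_mono) auto
    ultimately have "card {s. message a (pt s) \<noteq> 0} \<le> ?d"
      unfolding card_compl by (metis diff_le_mono2)
    moreover have ne: "word a \<noteq> 0"
      using nz inj_word[of a] by auto
    ultimately have "card {s. message a (pt s) \<noteq> 0} = ?d"
      using lower by (simp add: le_antisym)
    \<comment> \<open>The distance to the zero word is the weight.\<close>
    moreover have z: "word (\<lambda>i j. 0) = 0"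
      by (simp add: word_def message_def vec_eq_iff)
    ultimately have "hamming_dist (word a) (word (\<lambda>i j. 0)) = ?d"
      unfolding dist by simp
    moreover have "word a \<noteq> word (\<lambda>i j. 0)"
      using ne z by simp
    ultimately show "?d \<in> {hamming_dist c d |c d. c \<in> C \<and> d \<in> C \<and> c \<noteq> d}"
      unfolding C by (intro CollectI exI[of _ "word a"] exI[of _ "word (\<lambda>i j. 0)"]) simp
  qed
  \<comment> \<open>As \<open>r\<close> divides \<open>k\<close>, the ceiling in the distance bound
    is exactly \<open>m\<close>.\<close>
  moreover have "real k / real r = real m"
    using km r_pos by simp
  moreover have "int ?d = int ((r + 1) * l) - int k - int m + 2"
  proof -
    have "int ?d = int ((r + 1) * l) - int ?N"
      using N_less by (intro of_nat_diff) simp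
    moreover have "int ?N + 2 = int k + int m"
      using arg_cong[OF N_eq, of int] by (simp add: km algebra_simps)
    ultimately show ?thesis by simp
  qed
  ultimately show ?thesis
    unfolding optimal_lrc_def using lrc by simp
qed

end
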